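(* Let $X$ be a real vector space ordered by an Archimedean cone $K$, with Thompson metric $d$. 1. If $(x_n)$ is an increasing sequence in $K$, then $(x_n)$ is $d$-convergent to an $x\in K$ iff (i) $x_n\le x$ for all $n\in\mathbb{N}$, and (ii) for every $\lambda>1$ there exists $k\in\mathbb{N}$ such that $x\le\lambda x_k$. In this case $x=\sup_n x_n$ and there exists $k\in\mathbb{N}$ such that $x_n\in K(x)$ for all $n\ge k$. 2. If $(x_n)$ is a decreasing sequence in $K$, then $(x_n)$ is $d$-convergent to an $x\in K$ iff (i) $x\le x_n$ for all $n\in\mathbb{N}$, and (ii) for every $\lambda\in(0,1)$ there exists $k\in\mathbb{N}$ such that $x\ge\lambda x_k$. In this case $x=\inf_n x_n$ and there exists $k\in\mathbb{N}$ such that $x_n\in K(x)$ for all $n\ge k$. 3. Let $(X,\tau)$ be a real topological vector space ordered by a $\tau$-closed cone $K$. If $(x_n)$ is a $d$-Cauchy sequence in $K$ which is $\tau$-convergent to $x\in K$, then $(x_n)$ is $d$-convergent to $x$.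
   Context: A cone $K$ in a real vector space $X$ is a nonempty subset with $K+K\subset K$, $tK\subset K$ for all $t\ge 0$, and $K\cap(-K)=\{0\}$; it induces the order $x\le y\iff y-x\in K$. $K$ is Archimedean if ($nx\le y$ for all $n\in\mathbb{N}$) implies $x\le 0$. Two elements $x,y\in K$ are linked if there are $\lambda,\mu>0$ with $x\le\lambda y$ and $y\le\mu x$; this is an equivalence relation on $K$, and $K(x)$ denotes the class (component) of $x$. The Thompson metric is $d(x,y)=\inf\{s\ge 0: e^{-s}x\le y\le e^{s}x\}$ for $x,y\in K$, with $\inf\emptyset=\infty$ (an extended semimetric on $K$); $d$-convergence to $x$ means $d(x_n,x)\to 0$, and $d$-Cauchy sequences are defined as usual. *)

theory Defs
  imports "HOL-Analysis.Analysis"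
begin

(* The library predicate cone only asks for closure under nonnegative scaling;
   the cones considered here are also convex and pointed. *)
definition ordering_cone :: "'a::real_vector set \<Rightarrow> bool" where
  "ordering_cone K \<longleftrightarrow>
     K \<noteq> {} \<and>
     (\<forall>x\<in>K. \<forall>y\<in>K. x + y \<in> K) \<and>
     (\<forall>t\<ge>0. \<forall>x\<in>K. t *\<^sub>R x \<in> K) \<and>
     K \<inter> uminus ` K = {0}"

definition cone_le :: "'a::real_vector \<Rightarrow> 'a set \<Rightarrow> 'a \<Rightarrow> bool"
    (\<open>(_ \<preceq>\<^bsub>_\<^esub> _)\<close> [51, 0, 51] 50) where
  "x \<preceq>\<^bsub>K\<^esub> y \<longleftrightarrow> y - x \<in> K"

(* Letting n start at 1 instead of 0 gives an equivalent notion for cones: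
   replace y by y - x. *)
definition archimedean_cone :: "'a::real_vector set \<Rightarrow> bool" where
  "archimedean_cone K \<longleftrightarrow>
     (\<forall>x y. (\<forall>n::nat. real n *\<^sub>R x \<preceq>\<^bsub>K\<^esub> y) \<longrightarrow> x \<preceq>\<^bsub>K\<^esub> 0)"

definition linked :: "'a::real_vector set \<Rightarrow> 'a \<Rightarrow> 'a \<Rightarrow> bool" where
  "linked K x y \<longleftrightarrow> (\<exists>l>0. \<exists>m>0. x \<preceq>\<^bsub>K\<^esub> l *\<^sub>R y \<and> y \<preceq>\<^bsub>K\<^esub> m *\<^sub>R x)"

definition component_of :: "'a::real_vector set \<Rightarrow> 'a \<Rightarrow> 'a set" where
  "component_of K x = {y \<in> K. linked K x y}"

(* Meaningful for x, y in K. In ereal the infimum of the empty set is \<infinity>. *)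
definition thompson :: "'a::real_vector set \<Rightarrow> 'a \<Rightarrow> 'a \<Rightarrow> ereal" where
  "thompson K x y =
     (INF s \<in> {s::real. 0 \<le> s \<and> exp (- s) *\<^sub>R x \<preceq>\<^bsub>K\<^esub> y \<and> y \<preceq>\<^bsub>K\<^esub> exp s *\<^sub>R x}. ereal s)"

definition thompson_convergent :: "'a::real_vector set \<Rightarrow> (nat \<Rightarrow> 'a) \<Rightarrow> 'a \<Rightarrow> bool" where
  "thompson_convergent K X x \<longleftrightarrow> (\<lambda>n. thompson K (X n) x) \<longlonglongrightarrow> 0"

definition thompson_Cauchy :: "'a::real_vector set \<Rightarrow> (nat \<Rightarrow> 'a) \<Rightarrow> bool" where
  "thompson_Cauchy K X \<longleftrightarrow>
     (\<forall>e::real. e > 0 \<longrightarrow> (\<exists>N. \<forall>m\<ge>N. \<forall>n\<ge>N. thompson K (X m) (X n) < ereal e))"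

definition cone_increasing :: "'a::real_vector set \<Rightarrow> (nat \<Rightarrow> 'a) \<Rightarrow> bool" where
  "cone_increasing K X \<longleftrightarrow> (\<forall>m n. m \<le> n \<longrightarrow> X m \<preceq>\<^bsub>K\<^esub> X n)"

definition cone_decreasing :: "'a::real_vector set \<Rightarrow> (nat \<Rightarrow> 'a) \<Rightarrow> bool" where
  "cone_decreasing K X \<longleftrightarrow> (\<forall>m n. m \<le> n \<longrightarrow> X n \<preceq>\<^bsub>K\<^esub> X m)"

(* Supremum and infimum are taken in the whole space, not just in K. *)
definition is_cone_sup :: "'a::real_vector set \<Rightarrow> 'a set \<Rightarrow> 'a \<Rightarrow> bool" where
  "is_cone_sup K A x \<longleftrightarrow>
     (\<forall>a\<in>A. a \<preceq>\<^bsub>K\<^esub> x) \<and> (\<forall>z. (\<forall>a\<in>A. a \<preceq>\<^bsub>K\<^esub> z) \<longrightarrow> x \<preceq>\<^bsub>K\<^esub> z)"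

definition is_cone_inf :: "'a::real_vector set \<Rightarrow> 'a set \<Rightarrow> 'a \<Rightarrow> bool" where
  "is_cone_inf K A x \<longleftrightarrow>
     (\<forall>a\<in>A. x \<preceq>\<^bsub>K\<^esub> a) \<and> (\<forall>z. (\<forall>a\<in>A. z \<preceq>\<^bsub>K\<^esub> a) \<longrightarrow> z \<preceq>\<^bsub>K\<^esub> x)"

(* No Hausdorff axiom: it is automatic once a pointed cone is closed. *)
definition vector_topology :: "'a::real_vector topology \<Rightarrow> bool" where
  "vector_topology T \<longleftrightarrow>
     topspace T = UNIV \<and>
     continuous_map (prod_topology T T) T (\<lambda>(x, y). x + y) \<and>
     continuous_map (prod_topology euclideanreal T) T (\<lambda>(a, x). a *\<^sub>R x)"

end

theory Submission
  imports Defs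
begin

text \<open>Writing \<open>l = exp s\<close>, Thompson convergence to \<open>x\<close> says that for each \<open>l > 1\<close> eventually
  \<open>X n \<le> l x\<close> and \<open>x \<le> l (X n)\<close>. For a monotone sequence one of these two inequalities holds
  at all large indices as soon as it holds at one, and the other one follows from the bound \<open>x\<close>;
  conversely the Archimedean property lets \<open>l\<close> tend to \<open>1\<close>. For the topological part, let one
  index of the Cauchy condition tend to infinity and use that \<open>K\<close> is closed.\<close>

text \<open>For \<open>n > 0\<close>, taking \<open>l = 1 + 1/n\<close> and multiplying by
  \<open>n\<close> gives \<open>n (a - b) \<le> b\<close>, so the Archimedean property forces
  \<open>a - b \<le> 0\<close>. This is the device by which factors \<open>l > 1\<close> are removed
  below.\<close>

lemma archimedean_cone_leI:
  assumes "archimedean_cone K" "b \<in> K" and le: "\<And>l. l > 1 \<Longrightarrow> a \<preceq>\<^bsub>K\<^esub> l *\<^sub>R b"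
    and cone: "ordering_cone K"
  shows "a \<preceq>\<^bsub>K\<^esub> b"
proof -
  have "real n *\<^sub>R (a - b) \<preceq>\<^bsub>K\<^esub> b" for n :: nat
  proof (cases "n = 0")
    case False
    then have "(1 + 1 / real n) *\<^sub>R b - a \<in> K"
      using le[of "1 + 1 / real n"] by (simp add: cone_le_def)
    then have "real n *\<^sub>R ((1 + 1 / real n) *\<^sub>R b - a) \<in> K"
      using cone by (simp add: ordering_cone_def)
    also have "real n *\<^sub>R ((1 + 1 / real n) *\<^sub>R b - a) = b - real n *\<^sub>R (a - b)"
      using False by (simp add: algebra_simps)
    finally show ?thesis by (simp add: cone_le_def)
  \<comment> \<open>The case \<open>n = 0\<close> reads \<open>0 \<le> b\<close>, which is the
    assumption that \<open>b\<close> lies in \<open>K\<close>.\<close>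
  qed (use assms in \<open>simp add: cone_le_def\<close>)
  then have "a - b \<preceq>\<^bsub>K\<^esub> 0"
    using assms(1) by (auto simp: archimedean_cone_def)
  then show ?thesis by (simp add: cone_le_def)
qed

section \<open>Order arithmetic in a fixed cone\<close>

context
  fixes K :: "'a::real_vector set"
  assumes cone: "ordering_cone K"
begin

lemma cone_add: "x \<in> K \<Longrightarrow> y \<in> K \<Longrightarrow> x + y \<in> K"
  and cone_scaleR: "0 \<le> t \<Longrightarrow> x \<in> K \<Longrightarrow> t *\<^sub>R x \<in> K"
  using cone by (auto simp: ordering_cone_def)

lemma cone_le_trans: "x \<preceq>\<^bsub>K\<^esub> y \<Longrightarrow> y \<preceq>\<^bsub>K\<^esub> z \<Longrightarrow> x \<preceq>\<^bsub>K\<^esub> z"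
  using cone_add[of "z - y" "y - x"] by (simp add: cone_le_def)

lemma cone_le_scaleR_mono: "x \<preceq>\<^bsub>K\<^esub> y \<Longrightarrow> 0 \<le> t \<Longrightarrow> t *\<^sub>R x \<preceq>\<^bsub>K\<^esub> t *\<^sub>R y"
  using cone_scaleR[of t "y - x"] by (simp add: cone_le_def scaleR_diff_right)

lemma cone_scaleR_left_mono: "x \<in> K \<Longrightarrow> s \<le> t \<Longrightarrow> s *\<^sub>R x \<preceq>\<^bsub>K\<^esub> t *\<^sub>R x"
  using cone_scaleR[of "t - s" x] by (simp add: cone_le_def scaleR_diff_left)

lemma cone_le_scaleR: "x \<in> K \<Longrightarrow> 1 \<le> t \<Longrightarrow> x \<preceq>\<^bsub>K\<^esub> t *\<^sub>R x"
  using cone_scaleR_left_mono[of x 1 t] by simp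

text \<open>With \<open>t = exp s\<close> this turns the lower bound in the definition of
  \<open>thompson\<close> into \<open>x \<le> exp s y\<close>, so that the two bounds become
  symmetric in \<open>x\<close> and \<open>y\<close>.\<close>

lemma inverse_scaleR_cone_le_iff:
  assumes "t > 0"
  shows "inverse t *\<^sub>R x \<preceq>\<^bsub>K\<^esub> y \<longleftrightarrow> x \<preceq>\<^bsub>K\<^esub> t *\<^sub>R y"
  using cone_le_scaleR_mono[of "inverse t *\<^sub>R x" y t]
    cone_le_scaleR_mono[of x "t *\<^sub>R y" "inverse t"] assms by auto

section \<open>The Thompson metric in terms of order inequalities\<close>

lemma thompson_nonneg: "0 \<le> thompson K x y"
  by (auto simp: thompson_def intro!: INF_greatest)

lemma thompson_le:
  assumes "0 \<le> s" "x \<preceq>\<^bsub>K\<^esub> exp s *\<^sub>R y" "y \<preceq>\<^bsub>K\<^esub> exp s *\<^sub>R x"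
  shows "thompson K x y \<le> ereal s"
  using assms by (auto simp: thompson_def exp_minus inverse_scaleR_cone_le_iff intro!: INF_lower)

text \<open>An infimum strictly below \<open>e\<close> yields an admissible \<open>s < e\<close>.
  Since \<open>x\<close> and \<open>y\<close> lie in \<open>K\<close>, their multiples grow with the
  factor, so \<open>s\<close> may be replaced by \<open>e\<close>.\<close>

lemma thompson_less_imp:
  assumes "thompson K x y < ereal e" "x \<in> K" "y \<in> K"
  shows "x \<preceq>\<^bsub>K\<^esub> exp e *\<^sub>R y" "y \<preceq>\<^bsub>K\<^esub> exp e *\<^sub>R x"
proof -
  obtain s where s: "s < e" "x \<preceq>\<^bsub>K\<^esub> exp s *\<^sub>R y" "y \<preceq>\<^bsub>K\<^esub> exp s *\<^sub>R x"
    using assms(1) by (auto simp: thompson_def INF_less_iff exp_minus inverse_scaleR_cone_le_iff)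
  have "exp s *\<^sub>R z \<preceq>\<^bsub>K\<^esub> exp e *\<^sub>R z" if "z \<in> K" for z
    using s(1) that by (intro cone_scaleR_left_mono) auto
  with s assms(2,3) show "x \<preceq>\<^bsub>K\<^esub> exp e *\<^sub>R y" "y \<preceq>\<^bsub>K\<^esub> exp e *\<^sub>R x"
    by (blast intro: cone_le_trans)+
qed

text \<open>Replaces the limit in \<open>ereal\<close> by order inequalities, the form in which
  convergence is handled from here on.\<close>

lemma thompson_convergent_iff:
  assumes X: "\<And>n. X n \<in> K" and x: "x \<in> K"
  shows "thompson_convergent K X x \<longleftrightarrow>
    (\<forall>l>1. \<forall>\<^sub>F n in sequentially. X n \<preceq>\<^bsub>K\<^esub> l *\<^sub>R x \<and> x \<preceq>\<^bsub>K\<^esub> l *\<^sub>R X n)" (is "?L \<longleftrightarrow> ?R")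
proof
  assume ?L
  show ?R
  proof (intro allI impI)
    fix l :: real
    assume "l > 1"
    then have "\<forall>\<^sub>F n in sequentially. thompson K (X n) x < ereal (ln l)"
      using \<open>?L\<close> by (intro order_tendstoD(2)[of _ 0]) (auto simp: thompson_convergent_def)
    then show "\<forall>\<^sub>F n in sequentially. X n \<preceq>\<^bsub>K\<^esub> l *\<^sub>R x \<and> x \<preceq>\<^bsub>K\<^esub> l *\<^sub>R X n"
      using thompson_less_imp[OF _ X x, of _ "ln l"] \<open>l > 1\<close> by (auto elim: eventually_mono)
  qed
next
  assume R: ?R
  show ?L
    unfolding thompson_convergent_def
  proof (rule order_tendstoI)
    fix u :: ereal
    assume "0 < u"
    \<comment> \<open>Since \<open>u\<close> may be infinite, a real \<open>e\<close> strictly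
      between \<open>0\<close> and \<open>u\<close> is chosen.\<close>
    then obtain e where e: "0 < ereal e" "ereal e < u"
      using ereal_dense2 by blast
    then have "\<forall>\<^sub>F n in sequentially. X n \<preceq>\<^bsub>K\<^esub> exp e *\<^sub>R x \<and> x \<preceq>\<^bsub>K\<^esub> exp e *\<^sub>R X n"
      using R by simp
    then show "\<forall>\<^sub>F n in sequentially. thompson K (X n) x < u"
    proof (rule eventually_mono)
      fix n
      assume "X n \<preceq>\<^bsub>K\<^esub> exp e *\<^sub>R x \<and> x \<preceq>\<^bsub>K\<^esub> exp e *\<^sub>R X n"
      then have "thompson K (X n) x \<le> ereal e"
        using e by (intro thompson_le) auto
      then show "thompson K (X n) x < u"
        using e(2) by (rule le_less_trans)
    qed
  \<comment> \<open>What remains is the lower half of the limit: every bound below \<open>0\<close>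
    is exceeded because the metric is nonnegative.\<close>
  qed (auto intro: always_eventually less_le_trans[OF _ thompson_nonneg])
qed

lemma thompson_convergent_imp_component:
  assumes "\<And>n. X n \<in> K" "x \<in> K" "thompson_convergent K X x"
  shows "\<exists>k. \<forall>n\<ge>k. X n \<in> component_of K x"
proof -
  \<comment> \<open>Any factor above \<open>1\<close> would do; \<open>2\<close> then serves as both
    linking constants.\<close>
  have "\<forall>\<^sub>F n in sequentially. X n \<preceq>\<^bsub>K\<^esub> 2 *\<^sub>R x \<and> x \<preceq>\<^bsub>K\<^esub> 2 *\<^sub>R X n"
    using assms thompson_convergent_iff[of X x] by simp
  then have "\<forall>\<^sub>F n in sequentially. X n \<in> component_of K x"
    by (rule eventually_mono)
      (use assms(1) in \<open>auto simp: component_of_def linked_def intro!: exI[of _ 2]\<close>)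
  then show ?thesis by (simp add: eventually_sequentially)
qed

section \<open>Increasing sequences\<close>

lemma increasing_thompson_convergent_iff:
  assumes "archimedean_cone K" and X: "\<And>n. X n \<in> K" and x: "x \<in> K"
    and inc: "cone_increasing K X"
  shows "thompson_convergent K X x \<longleftrightarrow>
    (\<forall>n. X n \<preceq>\<^bsub>K\<^esub> x) \<and> (\<forall>l>1. \<exists>k. x \<preceq>\<^bsub>K\<^esub> l *\<^sub>R X k)" (is "?L \<longleftrightarrow> ?R")
proof
  assume ?L
  then have ev: "\<exists>N. \<forall>n\<ge>N. X n \<preceq>\<^bsub>K\<^esub> l *\<^sub>R x \<and> x \<preceq>\<^bsub>K\<^esub> l *\<^sub>R X n" if "l > 1" for l
    using that thompson_convergent_iff[OF X x] by (simp add: eventually_sequentially)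
  have "X n \<preceq>\<^bsub>K\<^esub> x" for n
  proof (rule archimedean_cone_leI[OF assms(1) x _ cone])
    fix l :: real
    assume "l > 1"
    then obtain N where "\<forall>m\<ge>N. X m \<preceq>\<^bsub>K\<^esub> l *\<^sub>R x"
      using ev by blast
    \<comment> \<open>The index \<open>max n N\<close> is late enough for the convergence estimate
      and still comparable with \<open>n\<close> by monotonicity.\<close>
    then have "X (max n N) \<preceq>\<^bsub>K\<^esub> l *\<^sub>R x" by simp
    moreover have "X n \<preceq>\<^bsub>K\<^esub> X (max n N)"
      using inc by (simp add: cone_increasing_def)
    ultimately show "X n \<preceq>\<^bsub>K\<^esub> l *\<^sub>R x" by (blast intro: cone_le_trans)
  qed
  then show ?R using ev by blast
next
  assume R: ?R
  show ?L
    unfolding thompson_convergent_iff[OF X x] eventually_sequentially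
  proof (intro allI impI)
    fix l :: real
    assume l: "l > 1"
    then obtain k where k: "x \<preceq>\<^bsub>K\<^esub> l *\<^sub>R X k" using R by blast
    have "X n \<preceq>\<^bsub>K\<^esub> l *\<^sub>R x \<and> x \<preceq>\<^bsub>K\<^esub> l *\<^sub>R X n" if "n \<ge> k" for n
    proof
      show "X n \<preceq>\<^bsub>K\<^esub> l *\<^sub>R x"
        using R l x by (intro cone_le_trans[OF _ cone_le_scaleR]) auto
      have "l *\<^sub>R X k \<preceq>\<^bsub>K\<^esub> l *\<^sub>R X n"
        using inc that l by (intro cone_le_scaleR_mono) (auto simp: cone_increasing_def)
      with k show "x \<preceq>\<^bsub>K\<^esub> l *\<^sub>R X n" by (rule cone_le_trans)
    qed
    then show "\<exists>N. \<forall>n\<ge>N. X n \<preceq>\<^bsub>K\<^esub> l *\<^sub>R x \<and> x \<preceq>\<^bsub>K\<^esub> l *\<^sub>R X n" by blast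
  qed
qed

text \<open>For an upper bound \<open>z\<close>, the chain \<open>x \<le> l (X k) \<le> l z\<close>
  holds for each \<open>l > 1\<close> with a suitable \<open>k\<close>; then \<open>l\<close> tends
  to \<open>1\<close>.\<close>

lemma increasing_thompson_convergent_sup:
  assumes "archimedean_cone K" and X: "\<And>n. X n \<in> K" and x: "x \<in> K"
    and inc: "cone_increasing K X" and conv: "thompson_convergent K X x"
  shows "is_cone_sup K (range X) x"
proof -
  have R: "\<forall>n. X n \<preceq>\<^bsub>K\<^esub> x" "\<forall>l>1. \<exists>k. x \<preceq>\<^bsub>K\<^esub> l *\<^sub>R X k"
    using conv increasing_thompson_convergent_iff[OF assms(1) X x inc] by auto
  have "x \<preceq>\<^bsub>K\<^esub> z" if z: "\<And>n. X n \<preceq>\<^bsub>K\<^esub> z" for z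
  proof (rule archimedean_cone_leI[OF assms(1) _ _ cone])
    \<comment> \<open>Upper bounds range over the whole space, but
      \<open>archimedean_cone_leI\<close> asks for a bound in \<open>K\<close>. Here
      \<open>z\<close> is the sum of \<open>X 0\<close> and \<open>z - X 0\<close>, both in
      \<open>K\<close>.\<close>
    show "z \<in> K"
      using cone_add[OF X[of 0], of "z - X 0"] z[of 0] by (simp add: cone_le_def)
    fix l :: real
    assume l: "l > 1"
    then obtain k where "x \<preceq>\<^bsub>K\<^esub> l *\<^sub>R X k" using R by blast
    moreover have "l *\<^sub>R X k \<preceq>\<^bsub>K\<^esub> l *\<^sub>R z"
      using z l by (intro cone_le_scaleR_mono) auto
    ultimately show "x \<preceq>\<^bsub>K\<^esub> l *\<^sub>R z" by (rule cone_le_trans)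
  qed
  with R show ?thesis by (auto simp: is_cone_sup_def)
qed

section \<open>Decreasing sequences\<close>

lemma decreasing_thompson_convergent_iff:
  assumes "archimedean_cone K" and X: "\<And>n. X n \<in> K" and x: "x \<in> K"
    and dec: "cone_decreasing K X"
  shows "thompson_convergent K X x \<longleftrightarrow>
    (\<forall>n. x \<preceq>\<^bsub>K\<^esub> X n) \<and> (\<forall>l. 0 < l \<and> l < 1 \<longrightarrow> (\<exists>k. l *\<^sub>R X k \<preceq>\<^bsub>K\<^esub> x))" (is "?L \<longleftrightarrow> ?R")
proof
  assume ?L
  then have ev: "\<exists>N. \<forall>n\<ge>N. X n \<preceq>\<^bsub>K\<^esub> l *\<^sub>R x \<and> x \<preceq>\<^bsub>K\<^esub> l *\<^sub>R X n" if "l > 1" for l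
    using that thompson_convergent_iff[OF X x] by (simp add: eventually_sequentially)
  have "x \<preceq>\<^bsub>K\<^esub> X n" for n
  proof (rule archimedean_cone_leI[OF assms(1) X _ cone])
    fix l :: real
    assume l: "l > 1"
    then obtain N where "\<forall>m\<ge>N. x \<preceq>\<^bsub>K\<^esub> l *\<^sub>R X m"
      using ev by blast
    then have "x \<preceq>\<^bsub>K\<^esub> l *\<^sub>R X (max n N)" by simp
    moreover have "l *\<^sub>R X (max n N) \<preceq>\<^bsub>K\<^esub> l *\<^sub>R X n"
      using dec l by (intro cone_le_scaleR_mono) (auto simp: cone_decreasing_def)
    ultimately show "x \<preceq>\<^bsub>K\<^esub> l *\<^sub>R X n" by (rule cone_le_trans)
  qed
  \<comment> \<open>A factor \<open>l\<close> in \<open>(0,1)\<close> corresponds to the factor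
    \<open>inverse l > 1\<close> on the other side of the inequality.\<close>
  moreover have "\<exists>k. l *\<^sub>R X k \<preceq>\<^bsub>K\<^esub> x" if "0 < l" "l < 1" for l
    using ev[of "inverse l"] that inverse_scaleR_cone_le_iff[of "inverse l"]
    by (auto simp: one_less_inverse)
  ultimately show ?R by blast
next
  assume R: ?R
  show ?L
    unfolding thompson_convergent_iff[OF X x] eventually_sequentially
  proof (intro allI impI)
    fix l :: real
    assume l: "l > 1"
    then obtain k where "inverse l *\<^sub>R X k \<preceq>\<^bsub>K\<^esub> x"
      using R[THEN conjunct2, rule_format, of "inverse l"] by (auto simp: inverse_less_1_iff)
    then have k: "X k \<preceq>\<^bsub>K\<^esub> l *\<^sub>R x"
      using l by (simp add: inverse_scaleR_cone_le_iff)
    have "X n \<preceq>\<^bsub>K\<^esub> l *\<^sub>R x \<and> x \<preceq>\<^bsub>K\<^esub> l *\<^sub>R X n" if "n \<ge> k" for n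
    proof
      show "X n \<preceq>\<^bsub>K\<^esub> l *\<^sub>R x"
        using dec that by (intro cone_le_trans[OF _ k]) (auto simp: cone_decreasing_def)
      show "x \<preceq>\<^bsub>K\<^esub> l *\<^sub>R X n"
        using R l X by (intro cone_le_trans[OF _ cone_le_scaleR]) auto
    qed
    then show "\<exists>N. \<forall>n\<ge>N. X n \<preceq>\<^bsub>K\<^esub> l *\<^sub>R x \<and> x \<preceq>\<^bsub>K\<^esub> l *\<^sub>R X n" by blast
  qed
qed

text \<open>A lower bound \<open>z\<close> satisfies \<open>z \<le> X k \<le> l x\<close> for
  suitable \<open>k\<close>. The Archimedean lemma is applied with \<open>x\<close> as the bound in
  \<open>K\<close>, so \<open>z\<close> may be any vector.\<close>

lemma decreasing_thompson_convergent_inf: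
  assumes "archimedean_cone K" and X: "\<And>n. X n \<in> K" and x: "x \<in> K"
    and dec: "cone_decreasing K X" and conv: "thompson_convergent K X x"
  shows "is_cone_inf K (range X) x"
proof -
  have "z \<preceq>\<^bsub>K\<^esub> x" if z: "\<And>n. z \<preceq>\<^bsub>K\<^esub> X n" for z
  proof (rule archimedean_cone_leI[OF assms(1) x _ cone])
    fix l :: real
    assume "l > 1"
    then obtain k where "X k \<preceq>\<^bsub>K\<^esub> l *\<^sub>R x"
      using conv unfolding thompson_convergent_iff[OF X x] eventually_sequentially by blast
    with z show "z \<preceq>\<^bsub>K\<^esub> l *\<^sub>R x" by (blast intro: cone_le_trans)
  qed
  then show ?thesis
    using conv decreasing_thompson_convergent_iff[OF assms(1) X x dec] by (auto simp: is_cone_inf_def)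
qed

section \<open>Limits in a vector topology\<close>

lemma thompson_Cauchy_limitin_imp_convergent:
  assumes T: "vector_topology T" "closedin T K" and X: "\<And>n. X n \<in> K" and x: "x \<in> K"
    and Cauchy: "thompson_Cauchy K X" and lim: "limitin T X x sequentially"
  shows "thompson_convergent K X x"
  unfolding thompson_convergent_iff[OF X x] eventually_sequentially
proof (intro allI impI)
  \<comment> \<open>Both required inequalities say that an affine expression in the limit lies in
    \<open>K\<close>. The map \<open>y \<mapsto> a y + b\<close> is continuous, so membership on a
    tail passes to the limit in the closed set \<open>K\<close>.\<close>
  have affine_in_K: "a *\<^sub>R x + b \<in> K" if "\<And>m. m \<ge> N \<Longrightarrow> a *\<^sub>R X m + b \<in> K" for a b N
  proof -
    have "continuous_map T (prod_topology euclideanreal T) (\<lambda>y. (a, y))"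
      by (intro continuous_map_pairedI) auto
    then have "continuous_map T T (\<lambda>y. a *\<^sub>R y)"
      using continuous_map_compose[of T "prod_topology euclideanreal T" "\<lambda>y. (a, y)" T "\<lambda>(a, y). a *\<^sub>R y"] T(1)
      by (simp add: vector_topology_def o_def)
    then have "continuous_map T (prod_topology T T) (\<lambda>y. (a *\<^sub>R y, b))"
      using T(1) by (intro continuous_map_pairedI) (auto simp: vector_topology_def)
    then have "continuous_map T T (\<lambda>y. a *\<^sub>R y + b)"
      using continuous_map_compose[of T "prod_topology T T" "\<lambda>y. (a *\<^sub>R y, b)" T "\<lambda>(y, z). y + z"] T(1)
      by (simp add: vector_topology_def o_def)
    then have "limitin T (\<lambda>m. a *\<^sub>R X m + b) (a *\<^sub>R x + b) sequentially"
      using continuous_map_limit[OF _ lim] by (simp add: o_def)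
    moreover have "\<forall>\<^sub>F m in sequentially. a *\<^sub>R X m + b \<in> K"
      using that by (auto simp: eventually_sequentially)
    ultimately show ?thesis
      using limitin_closedin[OF _ T(2)] sequentially_bot by blast
  qed
  fix l :: real
  assume l: "l > 1"
  then have "ln l > 0" by simp
  then obtain N where N: "\<forall>m\<ge>N. \<forall>n\<ge>N. thompson K (X m) (X n) < ereal (ln l)"
    using Cauchy unfolding thompson_Cauchy_def by blast
  have XX: "X m \<preceq>\<^bsub>K\<^esub> l *\<^sub>R X n" if "m \<ge> N" "n \<ge> N" for m n
    using thompson_less_imp(1)[OF N[rule_format, OF that] X X] l by simp
  have "X n \<preceq>\<^bsub>K\<^esub> l *\<^sub>R x \<and> x \<preceq>\<^bsub>K\<^esub> l *\<^sub>R X n" if "n \<ge> N" for n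
    \<comment> \<open>With \<open>n\<close> fixed and \<open>m\<close> tending to infinity, the
      first instance is the limit of \<open>X n \<le> l (X m)\<close>, the second that of
      \<open>X m \<le> l (X n)\<close>.\<close>
    using affine_in_K[of N l "- X n"] affine_in_K[of N "-1" "l *\<^sub>R X n"] XX that
    by (auto simp: cone_le_def)
  then show "\<exists>N. \<forall>n\<ge>N. X n \<preceq>\<^bsub>K\<^esub> l *\<^sub>R x \<and> x \<preceq>\<^bsub>K\<^esub> l *\<^sub>R X n" by blast
qed

end

theorem proposition3p21:
  fixes K :: "'a::real_vector set"
  assumes cone: "ordering_cone K"
  shows
    "(archimedean_cone K \<longrightarrow>
       (\<forall>X. (\<forall>n. X n \<in> K) \<and> cone_increasing K X \<longrightarrow>
         (\<forall>x\<in>K.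
           (thompson_convergent K X x \<longleftrightarrow>
              (\<forall>n. X n \<preceq>\<^bsub>K\<^esub> x) \<and> (\<forall>l>1. \<exists>k. x \<preceq>\<^bsub>K\<^esub> l *\<^sub>R X k)) \<and>
           (thompson_convergent K X x \<longrightarrow>
              is_cone_sup K (range X) x \<and> (\<exists>k. \<forall>n\<ge>k. X n \<in> component_of K x)))))
     \<and>
     (archimedean_cone K \<longrightarrow>
       (\<forall>X. (\<forall>n. X n \<in> K) \<and> cone_decreasing K X \<longrightarrow>
         (\<forall>x\<in>K.
           (thompson_convergent K X x \<longleftrightarrow>
              (\<forall>n. x \<preceq>\<^bsub>K\<^esub> X n) \<and> (\<forall>l. 0 < l \<and> l < 1 \<longrightarrow> (\<exists>k. l *\<^sub>R X k \<preceq>\<^bsub>K\<^esub> x))) \<and>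
           (thompson_convergent K X x \<longrightarrow>
              is_cone_inf K (range X) x \<and> (\<exists>k. \<forall>n\<ge>k. X n \<in> component_of K x)))))
     \<and>
     (\<forall>T. vector_topology T \<and> closedin T K \<longrightarrow>
       (\<forall>X. (\<forall>n. X n \<in> K) \<and> thompson_Cauchy K X \<longrightarrow>
         (\<forall>x\<in>K. limitin T X x sequentially \<longrightarrow> thompson_convergent K X x)))"
  using increasing_thompson_convergent_iff[OF cone] increasing_thompson_convergent_sup[OF cone]
    decreasing_thompson_convergent_iff[OF cone] decreasing_thompson_convergent_inf[OF cone]
    thompson_convergent_imp_component[OF cone] thompson_Cauchy_limitin_imp_convergent[OF cone]
  by (intro conjI allI impI ballI; elim conjE) blast+

end
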